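(* Let $K>0$ be a constant with the following property: for every finite set $X$ and every non-trivial increasing family $\mathcal F \subset \mathcal P(X)$ with $l(\mathcal F) \ge 2$, one has $p_\mathrm{c}(\mathcal F) \le K\, q_\mathrm{c}(\mathcal F) \log_2 l(\mathcal F)$. Then for every finite set $X$ and every non-trivial increasing family $\mathcal F \subset \mathcal P(X)$ with $l(\mathcal F) \ge 2$, \[ p_\mathrm{c}(\mathcal F) \le 1 - \mathrm{e}^{-K q_\mathrm{c}(\mathcal F) \log_2 l(\mathcal F)}. \]
   Context: For a finite set $X$ and $p\in[0,1]$, $X_p$ denotes the random subset of $X$ containing each element independently with probability $p$. A family $\mathcal F\subset\mathcal P(X)$ is increasing if $A\in\mathcal F$ and $A\subset B\subset X$ imply $B\in\mathcal F$; it is non-trivial if $\mathcal F\neq\emptyset$ and $\mathcal F\neq \mathcal P(X)$. The threshold $p_\mathrm{c}(\mathcal F)$ is the unique $p\in(0,1)$ with $\mathbb P(X_p\in\mathcal F)=1/2$. For $\mathcal G\subset\mathcal P(X)$ and $q\in[0,1]$, $\mathrm{cost}_q(\mathcal G)=\sum_{S\in\mathcal G} q^{|S|}$; $\mathcal G$ is $q$-cheap if $\mathrm{cost}_q(\mathcal G)\le 1/2$; $\mathcal G$ covers $\mathcal F$ if every $T\in\mathcal F$ contains some $S\in\mathcal G$. The expectation threshold is $q_\mathrm{c}(\mathcal F)=\sup\{q\in[0,1]: \text{there exists a } q\text{-cheap cover of } \mathcal F\}$. $l(\mathcal F)$ denotes the size of a largest minimal element of $\mathcal F$. (By the Park–Pham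 theorem such a universal constant $K$ exists.) *)

theory Defs
  imports "HOL-Probability.Probability"
begin

definition random_subset :: "'a set \<Rightarrow> real \<Rightarrow> 'a set pmf" where
  "random_subset X p =
     map_pmf (\<lambda>f. {x \<in> X. f x}) (Pi_pmf X False (\<lambda>_. bernoulli_pmf p))"

definition increasing_family :: "'a set \<Rightarrow> 'a set set \<Rightarrow> bool" where
  "increasing_family X F \<longleftrightarrow>
     F \<subseteq> Pow X \<and> (\<forall>A B. A \<in> F \<longrightarrow> A \<subseteq> B \<longrightarrow> B \<subseteq> X \<longrightarrow> B \<in> F)"

definition nontrivial_family :: "'a set \<Rightarrow> 'a set set \<Rightarrow> bool" where
  "nontrivial_family X F \<longleftrightarrow> F \<noteq> {} \<and> F \<noteq> Pow X"

definition threshold :: "'a set \<Rightarrow> 'a set set \<Rightarrow> real" where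
  "threshold X F =
     (THE p. 0 < p \<and> p < 1 \<and> measure_pmf.prob (random_subset X p) F = 1 / 2)"

definition cost :: "real \<Rightarrow> 'a set set \<Rightarrow> real" where
  "cost q G = (\<Sum>S\<in>G. q ^ card S)"

definition cheap :: "real \<Rightarrow> 'a set set \<Rightarrow> bool" where
  "cheap q G \<longleftrightarrow> cost q G \<le> 1 / 2"

definition covers :: "'a set set \<Rightarrow> 'a set set \<Rightarrow> bool" where
  "covers G F \<longleftrightarrow> (\<forall>T\<in>F. \<exists>S\<in>G. S \<subseteq> T)"

definition expectation_threshold :: "'a set \<Rightarrow> 'a set set \<Rightarrow> real" where
  "expectation_threshold X F =
     Sup {q \<in> {0..1}. \<exists>G. G \<subseteq> Pow X \<and> cheap q G \<and> covers G F}"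

definition minimal_elements :: "'a set set \<Rightarrow> 'a set set" where
  "minimal_elements F = {A \<in> F. \<forall>B\<in>F. B \<subseteq> A \<longrightarrow> B = A}"

definition largest_minimal_size :: "'a set set \<Rightarrow> nat" where
  "largest_minimal_size F = Max (card ` minimal_elements F)"

end

theory Submission
  imports Defs
begin

text \<open>
  Replace every point of \<open>X\<close> by \<open>N\<close> copies and let \<open>F'\<close> be the family of those sets of copies
  whose projection to \<open>X\<close> lies in \<open>F\<close>. The minimal elements keep their sizes, and the projection of
  a \<open>p'\<close>-random set of copies is a \<open>(1 - (1 - p')^N)\<close>-random subset of \<open>X\<close>, so the thresholds satisfy
  \<open>1 - p = (1 - p')^N\<close>. Restricting a \<open>q'\<close>-cheap cover of \<open>F'\<close> to a uniformly random choice of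
  one copy per point gives a cover of \<open>F\<close> whose expected cost at \<open>N q'\<close> is at most \<open>1/2\<close>; hence
  the expectation threshold drops by the factor \<open>N\<close>. The hypothesis for \<open>F'\<close> thus reads \<open>p' \<le> c / N\<close>
  with \<open>c = K q log\<^sub>2 l\<close>, and \<open>1 - p \<ge> (1 - c / N)^N\<close> tends to \<open>exp (- c)\<close>.
\<close>

section \<open>Random subsets\<close>

lemma set_pmf_random_subset: "set_pmf (random_subset X p) \<subseteq> Pow X"
  by (auto simp: random_subset_def)

lemma pmf_random_subset:
  assumes "finite X" "A \<subseteq> X" "0 \<le> p" "p \<le> 1"
  shows "pmf (random_subset X p) A = p ^ card A * (1 - p) ^ card (X - A)"
proof -
  have "(\<lambda>f. {x \<in> X. f x}) -` {A} = Pi X (\<lambda>x. {x \<in> A})"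
    using \<open>A \<subseteq> X\<close> by (auto simp: Pi_iff)
  then have "pmf (random_subset X p) A = (\<Prod>x\<in>X. pmf (bernoulli_pmf p) (x \<in> A))"
    using \<open>finite X\<close> by (simp add: random_subset_def pmf_map measure_Pi_pmf_Pi measure_pmf_single)
  also have "\<dots> = (\<Prod>x\<in>X. if x \<in> A then p else 1 - p)"
    using assms by (intro prod.cong) auto
  also have "\<dots> = p ^ card A * (1 - p) ^ card (X - A)"
    using assms by (simp add: prod.If_cases Int_absorb1 Diff_eq)
  finally show ?thesis .
qed

lemma prob_random_subset_Pow:
  assumes "finite X" "0 \<le> p" "p \<le> 1"
  shows "measure_pmf.prob (random_subset X p) (Pow B) = (1 - p) ^ card (X - B)"
proof -
  let ?C = "\<lambda>x. if x \<in> B then UNIV else {False}"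
  have "(\<lambda>f. {x \<in> X. f x}) -` Pow B = Pi X ?C"
    by (auto simp: Pi_iff split: if_splits)
  then have "measure_pmf.prob (random_subset X p) (Pow B) =
      (\<Prod>x\<in>X. measure_pmf.prob (bernoulli_pmf p) (?C x))"
    using \<open>finite X\<close> by (simp add: random_subset_def measure_Pi_pmf_Pi)
  also have "\<dots> = (\<Prod>x\<in>X. if x \<in> B then 1 else 1 - p)"
    using assms by (intro prod.cong) (auto simp: measure_pmf_single)
  also have "\<dots> = (1 - p) ^ card (X - B)"
    using assms by (simp add: prod.If_cases Diff_eq)
  finally show ?thesis .
qed

lemma pmf_set_eqI_prob_Pow:
  fixes P Q :: "'a set pmf"
  assumes "finite X" "set_pmf P \<subseteq> Pow X" "set_pmf Q \<subseteq> Pow X"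
    and prob_eq: "\<And>B. B \<subseteq> X \<Longrightarrow> measure_pmf.prob P (Pow B) = measure_pmf.prob Q (Pow B)"
  shows "P = Q"
proof (rule pmf_eqI)
  have pmf_eq: "pmf P B = pmf Q B" if "B \<subseteq> X" for B
    using finite_subset[OF that \<open>finite X\<close>] that
  proof (induction B rule: finite_psubset_induct)
    case (psubset B)
    have split: "measure_pmf.prob R (Pow B) = pmf R B + (\<Sum>C\<in>Pow B - {B}. pmf R C)"
      for R :: "'a set pmf"
      using \<open>finite B\<close> by (simp add: measure_measure_pmf_finite sum.remove[of _ B])
    have "(\<Sum>C\<in>Pow B - {B}. pmf P C) = (\<Sum>C\<in>Pow B - {B}. pmf Q C)"
      using psubset by (intro sum.cong) auto
    then show ?case
      using prob_eq[OF psubset.prems] by (simp add: split)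
  qed
  show "pmf P B = pmf Q B" for B
  proof (cases "B \<subseteq> X")
    case False
    then have "B \<notin> set_pmf P" "B \<notin> set_pmf Q"
      using assms(2,3) by auto
    then show ?thesis
      by (simp add: set_pmf_iff)
  qed (rule pmf_eq)
qed

lemma random_subset_0: "finite X \<Longrightarrow> random_subset X 0 = return_pmf {}"
  by (rule pmf_set_eqI_prob_Pow[OF _ set_pmf_random_subset])
    (auto simp: prob_random_subset_Pow)

lemma random_subset_1:
  assumes "finite X"
  shows "random_subset X 1 = return_pmf X"
proof (rule pmf_set_eqI_prob_Pow[OF assms set_pmf_random_subset])
  fix B
  show "measure_pmf.prob (random_subset X 1) (Pow B) = measure_pmf.prob (return_pmf X) (Pow B)"
    using assms by (simp add: prob_random_subset_Pow power_0_left indicator_def)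
qed simp

lemma map_Un_random_subset:
  assumes "finite X" "0 \<le> p" "p \<le> 1" "0 \<le> q" "q \<le> 1"
  shows "map_pmf (\<lambda>(A, B). A \<union> B) (pair_pmf (random_subset X p) (random_subset X q)) =
    random_subset X (1 - (1 - p) * (1 - q))" (is "map_pmf _ ?M = random_subset X ?r")
proof (rule pmf_set_eqI_prob_Pow[OF \<open>finite X\<close> _ set_pmf_random_subset])
  show "set_pmf (map_pmf (\<lambda>(A, B). A \<union> B) ?M) \<subseteq> Pow X"
    using set_pmf_random_subset[of X] by force
  fix B assume "B \<subseteq> X"
  then have "finite (Pow B)"
    using \<open>finite X\<close> finite_subset by simp
  have "(\<lambda>(A, B). A \<union> B) -` Pow B = Pow B \<times> Pow B"
    by auto
  then have "measure_pmf.prob (map_pmf (\<lambda>(A, B). A \<union> B) ?M) (Pow B) =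
      measure_pmf.prob ?M (Pow B \<times> Pow B)"
    by simp
  also have "\<dots> = (1 - p) ^ card (X - B) * (1 - q) ^ card (X - B)"
    using assms \<open>finite (Pow B)\<close>
    by (simp add: measure_pmf_prob_product countable_finite prob_random_subset_Pow)
  also have "\<dots> = measure_pmf.prob (random_subset X ?r) (Pow B)"
    using assms by (simp add: prob_random_subset_Pow mult_le_one flip: power_mult_distrib)
  finally show "measure_pmf.prob (map_pmf (\<lambda>(A, B). A \<union> B) ?M) (Pow B) =
    measure_pmf.prob (random_subset X ?r) (Pow B)" .
qed

lemma continuous_on_prob_random_subset:
  assumes "finite X" "F \<subseteq> Pow X"
  shows "continuous_on {0..1} (\<lambda>p. measure_pmf.prob (random_subset X p) F)"
proof -
  have "finite F"
    using assms finite_subset by blast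
  then have prob_eq: "measure_pmf.prob (random_subset X p) F =
      (\<Sum>A\<in>F. p ^ card A * (1 - p) ^ card (X - A))"
    if "p \<in> {0..1}" for p
    using that assms by (auto simp: measure_measure_pmf_finite pmf_random_subset intro!: sum.cong)
  show ?thesis
    by (subst continuous_on_cong[OF refl prob_eq]) (simp, intro continuous_intros)
qed

section \<open>Thresholds of increasing families\<close>

locale nontrivial_increasing_family =
  fixes X :: "'a set" and F :: "'a set set"
  assumes finite_ground: "finite X"
    and increasing: "increasing_family X F"
    and nontrivial: "nontrivial_family X F"
begin

abbreviation prob :: "real \<Rightarrow> real" where
  "prob p \<equiv> measure_pmf.prob (random_subset X p) F"

lemma subset_Pow: "F \<subseteq> Pow X"
  using increasing by (simp add: increasing_family_def)

lemma upward_closed: "A \<in> F \<Longrightarrow> A \<subseteq> B \<Longrightarrow> B \<subseteq> X \<Longrightarrow> B \<in> F"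
  using increasing unfolding increasing_family_def by blast

lemma empty_notin: "{} \<notin> F"
  using subset_Pow upward_closed[of "{}"] nontrivial by (auto simp: nontrivial_family_def)

lemma ground_in: "X \<in> F"
  using subset_Pow upward_closed[of _ X] nontrivial unfolding nontrivial_family_def by blast

lemma prob_0: "prob 0 = 0"
  using finite_ground empty_notin by (simp add: random_subset_0)

lemma prob_1: "prob 1 = 1"
  using finite_ground ground_in by (simp add: random_subset_1)

text \<open>
  Sprinkling: for \<open>p < q\<close> a \<open>q\<close>-random subset is the union of a \<open>p\<close>-random and an independent
  \<open>r\<close>-random one, and with positive probability the former is \<open>{}\<close> and the latter is \<open>X\<close>.
\<close>
lemma strict_mono_on_prob: "strict_mono_on {0..1} prob"
proof (rule strict_mono_onI)
  fix p q :: real assume "p \<in> {0..1}" "q \<in> {0..1}" "p < q"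
  then have p: "0 \<le> p" "p < 1"
    by auto
  define r where "r = (q - p) / (1 - p)"
  have r: "0 < r" "r \<le> 1" and q_eq: "1 - (1 - p) * (1 - r) = q"
    using p \<open>p < q\<close> \<open>q \<in> {0..1}\<close> by (auto simp: r_def field_simps)
  let ?M = "pair_pmf (random_subset X p) (random_subset X r)"
  have "prob p < prob p + pmf ?M ({}, X)"
    using finite_ground p r by (simp add: pmf_pair pmf_random_subset)
  also have "\<dots> = measure_pmf.prob (map_pmf fst ?M) F + measure_pmf.prob ?M {({}, X)}"
    by (simp only: map_fst_pair_pmf measure_pmf_single)
  also have "\<dots> = measure_pmf.prob ?M (fst -` F \<union> {({}, X)})"
    using empty_notin by (subst measure_pmf.finite_measure_Union) auto
  also have "\<dots> \<le> measure_pmf.prob ?M ((\<lambda>(A, B). A \<union> B) -` F)"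
  proof (intro measure_pmf.finite_measure_mono_AE AE_pmfI impI)
    fix AB assume "AB \<in> set_pmf ?M" "AB \<in> fst -` F \<union> {({}, X)}"
    moreover from this have "fst AB \<union> snd AB \<subseteq> X"
      using set_pmf_random_subset[of X] by fastforce
    ultimately show "AB \<in> (\<lambda>(A, B). A \<union> B) -` F"
      using ground_in upward_closed[of "fst AB" "fst AB \<union> snd AB"] by auto
  qed simp
  also have "\<dots> = prob q"
    using map_Un_random_subset[OF finite_ground, of p r] p r q_eq by (simp flip: measure_map_pmf)
  finally show "prob p < prob q" .
qed

lemma ex1_prob_eq_half: "\<exists>!p. 0 < p \<and> p < 1 \<and> prob p = 1 / 2"
proof (rule ex_ex1I)
  obtain p where p: "0 \<le> p" "p \<le> 1" "prob p = 1 / 2"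
    using IVT'[of prob 0 "1 / 2" 1] prob_0 prob_1
      continuous_on_prob_random_subset[OF finite_ground subset_Pow] by auto
  moreover from this have "p \<noteq> 0" "p \<noteq> 1"
    using prob_0 prob_1 by auto
  ultimately show "\<exists>p. 0 < p \<and> p < 1 \<and> prob p = 1 / 2"
    by (intro exI[of _ p]) simp
next
  fix p q assume "0 < p \<and> p < 1 \<and> prob p = 1 / 2" "0 < q \<and> q < 1 \<and> prob q = 1 / 2"
  then show "p = q"
    using strict_mono_on_eqD[OF strict_mono_on_prob, of p q] by simp
qed

lemma threshold_pos: "0 < threshold X F"
  and threshold_less_one: "threshold X F < 1"
  and prob_threshold: "prob (threshold X F) = 1 / 2"
  using theI'[OF ex1_prob_eq_half] unfolding threshold_def by auto

lemma threshold_eqI: "0 < p \<Longrightarrow> p < 1 \<Longrightarrow> prob p = 1 / 2 \<Longrightarrow> threshold X F = p"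
  unfolding threshold_def by (rule the1_equality[OF ex1_prob_eq_half]) simp

end

section \<open>Expectation thresholds\<close>

definition cheaply_coverable :: "'a set \<Rightarrow> 'a set set \<Rightarrow> real \<Rightarrow> bool" where
  "cheaply_coverable X F q \<longleftrightarrow> (\<exists>G\<subseteq>Pow X. cheap q G \<and> covers G F)"

lemma expectation_threshold_eq_Sup:
  "expectation_threshold X F = Sup {q \<in> {0..1}. cheaply_coverable X F q}"
  by (simp add: expectation_threshold_def cheaply_coverable_def)

lemma cheaply_coverable_le_one:
  assumes "finite X" "F \<noteq> {}" "cheaply_coverable X F q"
  shows "q \<le> 1"
proof (rule ccontr)
  assume "\<not> q \<le> 1"
  obtain G where G: "G \<subseteq> Pow X" "cheap q G" "covers G F"
    using assms(3) by (auto simp: cheaply_coverable_def)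
  have "(\<Sum>S\<in>G. 1) \<le> cost q G"
    unfolding cost_def using \<open>\<not> q \<le> 1\<close> by (intro sum_mono one_le_power) auto
  then have "card G = 0"
    using \<open>cheap q G\<close> by (simp add: cheap_def)
  moreover have "finite G"
    using G(1) \<open>finite X\<close> finite_subset by blast
  moreover have "G \<noteq> {}"
    using G(3) \<open>F \<noteq> {}\<close> by (auto simp: covers_def)
  ultimately show False
    by simp
qed

lemma cheaply_coverable_0:
  assumes "finite X" "F \<subseteq> Pow X" "{} \<notin> F"
  shows "cheaply_coverable X F 0"
proof -
  have "card A \<noteq> 0" if "A \<in> F" for A
    using that assms finite_subset[of A X] by (auto simp: card_eq_0_iff)
  then have "cost 0 F = 0"
    by (auto simp: cost_def power_0_left intro: sum.neutral)
  then have "cheap 0 F" "covers F F"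
    by (auto simp: cheap_def covers_def)
  then show ?thesis
    using \<open>F \<subseteq> Pow X\<close> by (auto simp: cheaply_coverable_def)
qed

context nontrivial_increasing_family
begin

lemma expectation_threshold_ge:
  assumes "0 \<le> q" "cheaply_coverable X F q"
  shows "q \<le> expectation_threshold X F"
  unfolding expectation_threshold_eq_Sup
proof (rule cSup_upper)
  show "q \<in> {q \<in> {0..1}. cheaply_coverable X F q}"
    using assms cheaply_coverable_le_one[OF finite_ground] ground_in by auto
qed (auto intro: bdd_aboveI[of _ 1])

lemma expectation_threshold_le:
  assumes "\<And>q. 0 \<le> q \<Longrightarrow> cheaply_coverable X F q \<Longrightarrow> q \<le> b"
  shows "expectation_threshold X F \<le> b"
  unfolding expectation_threshold_eq_Sup
proof (rule cSup_least)
  have "0 \<in> {q \<in> {0..1}. cheaply_coverable X F q}"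
    using cheaply_coverable_0[OF finite_ground subset_Pow empty_notin] by simp
  then show "{q \<in> {0..1}. cheaply_coverable X F q} \<noteq> {}"
    by blast
qed (use assms in auto)

end

section \<open>Blowing up the ground set\<close>

locale blowup =
  fixes X :: "'a set" and Y :: "'b set" and \<pi> :: "'b \<Rightarrow> 'a" and N :: nat
  assumes finite_base: "finite X"
    and proj: "\<pi> \<in> Y \<rightarrow> X"
    and card_fibre: "x \<in> X \<Longrightarrow> card (\<pi> -` {x} \<inter> Y) = N"
    and N_pos: "0 < N"
begin

lemma finite_fibre: "x \<in> X \<Longrightarrow> finite (\<pi> -` {x} \<inter> Y)"
  using card_fibre N_pos by (intro card_ge_0_finite) simp

lemma vimage_eq_UN_fibres: "\<pi> -` Z \<inter> Y = (\<Union>x\<in>Z. \<pi> -` {x} \<inter> Y)"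
  by auto

lemma finite_total: "finite Y"
proof -
  have "finite (\<pi> -` X \<inter> Y)"
    unfolding vimage_eq_UN_fibres[of X] using finite_base finite_fibre by (rule finite_UN_I)
  moreover have "\<pi> -` X \<inter> Y = Y"
    using proj by auto
  ultimately show ?thesis
    by simp
qed

lemma proj_image: "\<pi> ` Y = X"
proof
  show "X \<subseteq> \<pi> ` Y"
  proof
    fix x assume "x \<in> X"
    then have "\<pi> -` {x} \<inter> Y \<noteq> {}"
      using card_fibre N_pos by fastforce
    then show "x \<in> \<pi> ` Y"
      by blast
  qed
qed (use proj in auto)

lemma card_vimage_proj:
  assumes "Z \<subseteq> X"
  shows "card (\<pi> -` Z \<inter> Y) = N * card Z"
proof -
  have "card (\<pi> -` Z \<inter> Y) = (\<Sum>x\<in>Z. card (\<pi> -` {x} \<inter> Y))"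
    unfolding vimage_eq_UN_fibres[of Z] using assms finite_base finite_fibre
    by (intro card_UN_disjoint) (auto dest: finite_subset)
  also have "\<dots> = (\<Sum>x\<in>Z. N)"
    using assms card_fibre by (intro sum.cong) auto
  finally show ?thesis
    by simp
qed

lemma map_image_random_subset:
  assumes "0 \<le> p" "p \<le> 1"
  shows "map_pmf ((`) \<pi>) (random_subset Y p) = random_subset X (1 - (1 - p) ^ N)"
proof (rule pmf_set_eqI_prob_Pow[OF finite_base _ set_pmf_random_subset])
  show "set_pmf (map_pmf ((`) \<pi>) (random_subset Y p)) \<subseteq> Pow X"
    using set_pmf_random_subset[of Y p] proj by fastforce
  fix B
  have "(`) \<pi> -` Pow B = Pow (\<pi> -` B)" and "Y - \<pi> -` B = \<pi> -` (X - B) \<inter> Y"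
    using proj by auto
  then have "measure_pmf.prob (map_pmf ((`) \<pi>) (random_subset Y p)) (Pow B) =
      (1 - p) ^ (N * card (X - B))"
    using assms by (simp add: prob_random_subset_Pow finite_total card_vimage_proj)
  also have "\<dots> = measure_pmf.prob (random_subset X (1 - (1 - p) ^ N)) (Pow B)"
    using assms finite_base by (simp add: prob_random_subset_Pow power_le_one power_mult)
  finally show "measure_pmf.prob (map_pmf ((`) \<pi>) (random_subset Y p)) (Pow B) =
    measure_pmf.prob (random_subset X (1 - (1 - p) ^ N)) (Pow B)" .
qed

definition lift :: "'a set set \<Rightarrow> 'b set set" where
  "lift F = {S. S \<subseteq> Y \<and> \<pi> ` S \<in> F}"

lemma prob_lift:
  assumes "0 \<le> p" "p \<le> 1"
  shows "measure_pmf.prob (random_subset Y p) (lift F) =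
    measure_pmf.prob (random_subset X (1 - (1 - p) ^ N)) F"
proof -
  have "measure_pmf.prob (random_subset Y p) (lift F) =
      measure_pmf.prob (random_subset Y p) ((`) \<pi> -` F)"
    using set_pmf_random_subset[of Y p]
    by (intro measure_pmf.finite_measure_eq_AE AE_pmfI) (auto simp: lift_def)
  then show ?thesis
    by (simp flip: map_image_random_subset[OF assms])
qed

lemma minimal_elements_lift_iff:
  "S \<in> minimal_elements (lift F) \<longleftrightarrow> S \<subseteq> Y \<and> inj_on \<pi> S \<and> \<pi> ` S \<in> minimal_elements F"
proof
  assume "S \<in> minimal_elements (lift F)"
  then have S: "S \<subseteq> Y" "\<pi> ` S \<in> F" and minimal: "\<And>T. T \<in> lift F \<Longrightarrow> T \<subseteq> S \<Longrightarrow> T = S"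
    by (auto simp: minimal_elements_def lift_def)
  have "inj_on \<pi> S \<and> \<pi> ` S = B" if B: "B \<in> F" "B \<subseteq> \<pi> ` S" for B
  proof -
    obtain T where T: "T \<subseteq> S" "inj_on \<pi> T" "B = \<pi> ` T"
      using B(2) subset_image_inj by metis
    with S B have "T = S"
      by (intro minimal) (auto simp: lift_def)
    with T show ?thesis
      by simp
  qed
  then show "S \<subseteq> Y \<and> inj_on \<pi> S \<and> \<pi> ` S \<in> minimal_elements F"
    using S by (auto simp: minimal_elements_def)
next
  assume S: "S \<subseteq> Y \<and> inj_on \<pi> S \<and> \<pi> ` S \<in> minimal_elements F"
  have "T = S" if T: "T \<in> lift F" "T \<subseteq> S" for T
  proof -
    have "\<pi> ` T = \<pi> ` S"
      using S T by (auto simp: minimal_elements_def lift_def image_mono)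
    then show ?thesis
      using S T inj_on_image_eq_iff by blast
  qed
  then show "S \<in> minimal_elements (lift F)"
    using S by (auto simp: minimal_elements_def lift_def)
qed

lemma image_minimal_elements_lift:
  assumes "F \<subseteq> Pow X"
  shows "(`) \<pi> ` minimal_elements (lift F) = minimal_elements F"
proof (intro equalityI subsetI)
  fix A assume A: "A \<in> minimal_elements F"
  then have "A \<subseteq> \<pi> ` Y"
    using assms by (auto simp: minimal_elements_def proj_image)
  then obtain S where "S \<subseteq> Y" "inj_on \<pi> S" "A = \<pi> ` S"
    by (auto simp: subset_image_inj)
  then show "A \<in> (`) \<pi> ` minimal_elements (lift F)"
    using A by (auto simp: minimal_elements_lift_iff)
qed (auto simp: minimal_elements_lift_iff)

lemma largest_minimal_size_lift:
  assumes "F \<subseteq> Pow X"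
  shows "largest_minimal_size (lift F) = largest_minimal_size F"
proof -
  have "card ` minimal_elements F = (\<lambda>S. card (\<pi> ` S)) ` minimal_elements (lift F)"
    by (simp add: image_image flip: image_minimal_elements_lift[OF assms])
  also have "\<dots> = card ` minimal_elements (lift F)"
    by (intro image_cong) (auto simp: minimal_elements_lift_iff card_image)
  finally show ?thesis
    by (simp add: largest_minimal_size_def)
qed

subsection \<open>Projecting covers along sections\<close>

definition sections :: "('a \<Rightarrow> 'b) set" where
  "sections = (\<Pi>\<^sub>E x\<in>X. \<pi> -` {x} \<inter> Y)"

lemma finite_sections: "finite sections"
  unfolding sections_def using finite_base finite_fibre by (intro finite_PiE)

lemma card_sections: "card sections = N ^ card X"
  unfolding sections_def using finite_base by (simp add: card_PiE card_fibre)

lemma sectionsD: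
  assumes "s \<in> sections" "x \<in> X"
  shows "s x \<in> Y" "\<pi> (s x) = x"
  using assms by (auto simp: sections_def PiE_iff)

lemma inj_on_section_image: "s \<in> sections \<Longrightarrow> inj_on \<pi> (s ` X)"
  by (intro inj_on_inverseI[where g = s]) (auto simp: sectionsD)

lemma section_through: "s \<in> sections \<Longrightarrow> y \<in> s ` X \<Longrightarrow> s (\<pi> y) = y"
  by (auto simp: sectionsD)

lemma inj_on_restrict_sections_through:
  "inj_on (\<lambda>s. restrict s (X - \<pi> ` S)) {s \<in> sections. S \<subseteq> s ` X}"
proof (rule inj_onI)
  fix s t
  assume s: "s \<in> {s \<in> sections. S \<subseteq> s ` X}" and t: "t \<in> {s \<in> sections. S \<subseteq> s ` X}"
    and eq: "restrict s (X - \<pi> ` S) = restrict t (X - \<pi> ` S)"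
  show "s = t"
  proof (rule extensionalityI[of _ X])
    fix x assume "x \<in> X"
    show "s x = t x"
    proof (cases "x \<in> \<pi> ` S")
      case True
      then obtain y where "y \<in> S" "x = \<pi> y"
        by blast
      then have "s x = y" "t x = y"
        using s t section_through by auto
      then show ?thesis
        by simp
    next
      case False
      then show ?thesis
        using eq \<open>x \<in> X\<close> by (metis DiffI restrict_apply')
    qed
  qed (use s t in \<open>auto simp: sections_def PiE_iff\<close>)
qed

lemma card_sections_through:
  assumes "S \<subseteq> Y"
  shows "card {s \<in> sections. S \<subseteq> s ` X} * N ^ card S \<le> N ^ card X" (is "card ?through * _ \<le> _")
proof (cases "inj_on \<pi> S")
  case True
  let ?Z = "X - \<pi> ` S"
  have subset: "\<pi> ` S \<subseteq> X"
    using assms proj by auto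
  have "(\<lambda>s. restrict s ?Z) ` ?through \<subseteq> (\<Pi>\<^sub>E x\<in>?Z. \<pi> -` {x} \<inter> Y)"
    by (intro image_subsetI) (auto simp: sectionsD restrict_PiE_iff)
  moreover have "finite (\<Pi>\<^sub>E x\<in>?Z. \<pi> -` {x} \<inter> Y)"
    using finite_base finite_fibre by (intro finite_PiE) auto
  ultimately have "card ?through \<le> card (\<Pi>\<^sub>E x\<in>?Z. \<pi> -` {x} \<inter> Y)"
    by (intro card_inj_on_le[OF inj_on_restrict_sections_through])
  also have "\<dots> = N ^ card ?Z"
    using finite_base by (simp add: card_PiE card_fibre)
  finally have "card ?through * N ^ card S \<le> N ^ (card ?Z + card S)"
    by (simp add: power_add)
  also have "card ?Z + card S = card X"
    using True subset finite_base card_mono[OF finite_base subset]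
    by (simp add: card_Diff_subset finite_subset card_image)
  finally show ?thesis .
next
  case False
  then have "?through = {}"
    using inj_on_section_image inj_on_subset by blast
  then show ?thesis
    by (simp only: card.empty)
qed

definition section_trace :: "('a \<Rightarrow> 'b) \<Rightarrow> 'b set set \<Rightarrow> 'a set set" where
  "section_trace s G = (`) \<pi> ` {S \<in> G. S \<subseteq> s ` X}"

lemma covers_section_trace:
  assumes "s \<in> sections" "F \<subseteq> Pow X" "covers G (lift F)"
  shows "covers (section_trace s G) F"
  unfolding covers_def
proof
  fix T assume "T \<in> F"
  then have "T \<subseteq> X"
    using assms by auto
  then have image: "\<pi> ` s ` T = T" and "s ` T \<subseteq> Y"
    using sectionsD[OF assms(1)] by force+
  then have "s ` T \<in> lift F"
    using \<open>T \<in> F\<close> by (simp add: lift_def)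
  then obtain S where S: "S \<in> G" "S \<subseteq> s ` T"
    using assms by (auto simp: covers_def)
  then have "\<pi> ` S \<in> section_trace s G"
    using \<open>T \<subseteq> X\<close> unfolding section_trace_def by blast
  moreover have "\<pi> ` S \<subseteq> T"
    using S image by blast
  ultimately show "\<exists>S\<in>section_trace s G. S \<subseteq> T" ..
qed

lemma cost_section_trace_le:
  fixes q :: real
  assumes "s \<in> sections" "finite G" "0 \<le> q"
  shows "cost q (section_trace s G) \<le> (\<Sum>S | S \<in> G \<and> S \<subseteq> s ` X. q ^ card S)"
proof -
  have "cost q (section_trace s G) \<le> (\<Sum>S | S \<in> G \<and> S \<subseteq> s ` X. q ^ card (\<pi> ` S))"
    unfolding cost_def section_trace_def
    using sum_image_le[of "{S \<in> G. S \<subseteq> s ` X}" "\<lambda>S. q ^ card S" "(`) \<pi>"] assms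
    by (simp add: o_def)
  also have "\<dots> = (\<Sum>S | S \<in> G \<and> S \<subseteq> s ` X. q ^ card S)"
    using inj_on_subset[OF inj_on_section_image[OF assms(1)]]
    by (intro sum.cong) (auto simp: card_image)
  finally show ?thesis .
qed

lemma sum_cost_section_trace_le:
  fixes q :: real
  assumes "G \<subseteq> Pow Y" "0 \<le> q"
  shows "(\<Sum>s\<in>sections. cost (N * q) (section_trace s G)) \<le> (\<Sum>s\<in>sections. cost q G)"
proof -
  have "finite G"
    using assms finite_total finite_subset by blast
  then have "(\<Sum>s\<in>sections. cost (N * q) (section_trace s G))
      \<le> (\<Sum>s\<in>sections. \<Sum>S | S \<in> G \<and> S \<subseteq> s ` X. (N * q) ^ card S)"
    using assms by (intro sum_mono cost_section_trace_le) auto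
  also have "\<dots> = (\<Sum>S\<in>G. \<Sum>s | s \<in> sections \<and> S \<subseteq> s ` X. (N * q) ^ card S)"
    using finite_sections \<open>finite G\<close> by (rule sum.swap_restrict)
  also have "\<dots> = (\<Sum>S\<in>G. real (card {s \<in> sections. S \<subseteq> s ` X} * N ^ card S) * q ^ card S)"
    by (simp add: power_mult_distrib mult.assoc)
  also have "\<dots> \<le> (\<Sum>S\<in>G. real (N ^ card X) * q ^ card S)"
    using assms by (intro sum_mono mult_right_mono of_nat_mono card_sections_through) auto
  also have "\<dots> = (\<Sum>s\<in>sections. cost q G)"
    by (simp add: cost_def card_sections flip: sum_distrib_left)
  finally show ?thesis .
qed

lemma cheaply_coverable_lift:
  fixes q :: real
  assumes "F \<subseteq> Pow X" "0 \<le> q" "cheaply_coverable Y (lift F) q"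
  shows "cheaply_coverable X F (N * q)"
proof -
  obtain G where G: "G \<subseteq> Pow Y" "cheap q G" "covers G (lift F)"
    using assms(3) by (auto simp: cheaply_coverable_def)
  have "sections \<noteq> {}"
    using card_sections N_pos by auto
  then obtain s where s: "s \<in> sections" "cost (N * q) (section_trace s G) \<le> cost q G"
    using sum_cost_section_trace_le[OF G(1) assms(2)] finite_sections
      sum_strict_mono[of sections "\<lambda>_. cost q G" "\<lambda>s. cost (N * q) (section_trace s G)"]
    by (meson not_le)
  have "section_trace s G \<subseteq> Pow X"
    using G(1) proj by (auto simp: section_trace_def)
  moreover have "cheap (N * q) (section_trace s G)"
    using s(2) G(2) by (simp add: cheap_def)
  ultimately show ?thesis
    using covers_section_trace[OF s(1) assms(1) G(3)] by (auto simp: cheaply_coverable_def)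
qed

end

subsection \<open>Thresholds of the lifted family\<close>

locale family_blowup = nontrivial_increasing_family X F + blowup X Y \<pi> N
  for X :: "'a set" and F and Y :: "'b set" and \<pi> N

sublocale family_blowup \<subseteq> lifted: nontrivial_increasing_family Y "lift F"
proof
  show "increasing_family Y (lift F)"
    unfolding increasing_family_def
  proof (intro conjI allI impI)
    fix A B assume "A \<in> lift F" "A \<subseteq> B" "B \<subseteq> Y"
    moreover from this have "\<pi> ` A \<subseteq> \<pi> ` B" "\<pi> ` B \<subseteq> X"
      using proj by auto
    ultimately show "B \<in> lift F"
      using upward_closed by (auto simp: lift_def)
  qed (auto simp: lift_def)
  have "Y \<in> lift F" "{} \<notin> lift F"
    using ground_in empty_notin by (simp_all add: lift_def proj_image)
  then show "nontrivial_family Y (lift F)"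
    by (auto simp: nontrivial_family_def)
qed (rule finite_total)

context family_blowup
begin

lemma threshold_lift: "threshold X F = 1 - (1 - threshold Y (lift F)) ^ N"
proof (rule threshold_eqI)
  have p': "0 < threshold Y (lift F)" "threshold Y (lift F) < 1"
    by (rule lifted.threshold_pos lifted.threshold_less_one)+
  then show "0 < 1 - (1 - threshold Y (lift F)) ^ N" "1 - (1 - threshold Y (lift F)) ^ N < 1"
    using N_pos by (auto simp: power_less_one_iff)
  show "prob (1 - (1 - threshold Y (lift F)) ^ N) = 1 / 2"
    using p' lifted.prob_threshold by (simp add: prob_lift)
qed

lemma expectation_threshold_lift:
  "expectation_threshold Y (lift F) \<le> expectation_threshold X F / N"
proof (rule lifted.expectation_threshold_le)
  fix q assume "0 \<le> q" "cheaply_coverable Y (lift F) q"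
  then have "N * q \<le> expectation_threshold X F"
    by (intro expectation_threshold_ge cheaply_coverable_lift subset_Pow) auto
  then show "q \<le> expectation_threshold X F / N"
    using N_pos by (simp add: field_simps)
qed

lemma power_le_one_minus_threshold:
  assumes "0 \<le> a" "a * expectation_threshold X F \<le> N"
    and lifted_bound: "threshold Y (lift F) \<le> a * expectation_threshold Y (lift F)"
  shows "(1 - a * expectation_threshold X F / N) ^ N \<le> 1 - threshold X F"
proof -
  have "a * expectation_threshold Y (lift F) \<le> a * expectation_threshold X F / N"
    using mult_left_mono[OF expectation_threshold_lift \<open>0 \<le> a\<close>] by simp
  with lifted_bound
  have "(1 - a * expectation_threshold X F / N) ^ N \<le> (1 - threshold Y (lift F)) ^ N"
    using assms(2) N_pos by (intro power_mono) auto
  then show ?thesis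
    by (simp add: threshold_lift)
qed

end

lemma blowup_nat_exists:
  assumes "finite X" "0 < N"
  obtains Y :: "nat set" and \<pi> where "blowup X Y \<pi> N"
proof -
  define Y where "Y = {0..<card (X \<times> {..<N})}"
  obtain h where h: "bij_betw h Y (X \<times> {..<N})"
    using ex_bij_betw_nat_finite[of "X \<times> {..<N}"] assms by (auto simp: Y_def)
  have "blowup X Y (fst \<circ> h) N"
  proof
    fix x assume "x \<in> X"
    have "h ` ((fst \<circ> h) -` {x} \<inter> Y) = fst -` {x} \<inter> h ` Y"
      by auto
    also have "\<dots> = {x} \<times> {..<N}"
      using \<open>x \<in> X\<close> by (auto simp: bij_betw_imp_surj_on[OF h])
    finally have "bij_betw h ((fst \<circ> h) -` {x} \<inter> Y) ({x} \<times> {..<N})"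
      by (intro bij_betw_subset[OF h]) auto
    then show "card ((fst \<circ> h) -` {x} \<inter> Y) = N"
      by (simp add: bij_betw_same_card card_cartesian_product)
  qed (use assms bij_betwE[OF h] in auto)
  then show thesis
    by (rule that)
qed

lemma (in nontrivial_increasing_family) threshold_le_one_minus_exp:
  assumes "0 \<le> a"
    and blowup_bound: "\<And>(Y :: nat set) \<pi> N. family_blowup X F Y \<pi> N \<Longrightarrow>
      threshold Y (blowup.lift Y \<pi> F) \<le> a * expectation_threshold Y (blowup.lift Y \<pi> F)"
  shows "threshold X F \<le> 1 - exp (- (a * expectation_threshold X F))"
proof -
  let ?c = "a * expectation_threshold X F"
  have bound: "(1 + - ?c / real N) ^ N \<le> 1 - threshold X F" if "0 < N" "?c \<le> real N" for N
  proof -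
    obtain Y :: "nat set" and \<pi> where "blowup X Y \<pi> N"
      using blowup_nat_exists[OF finite_ground \<open>0 < N\<close>] .
    then interpret family_blowup X F Y \<pi> N
      by (intro family_blowup.intro nontrivial_increasing_family_axioms)
    show ?thesis
      using power_le_one_minus_threshold[OF \<open>0 \<le> a\<close>] blowup_bound[OF family_blowup_axioms] that
      by simp
  qed
  have "\<forall>\<^sub>F N in sequentially. (1 + - ?c / real N) ^ N \<le> 1 - threshold X F"
    using eventually_gt_at_top[of 0] eventually_ge_at_top[of "nat \<lceil>?c\<rceil>"]
    by eventually_elim (rule bound, auto)
  then have "exp (- ?c) \<le> 1 - threshold X F"
    using tendsto_exp_limit_sequentially[of "- ?c"] by (intro tendsto_upperbound) auto
  then show ?thesis
    by simp
qed

theorem theorem1p2: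
  fixes K :: real
  assumes "K > 0"
    and "\<And>(X :: nat set) (F :: nat set set).
           finite X \<Longrightarrow> increasing_family X F \<Longrightarrow> nontrivial_family X F \<Longrightarrow>
           largest_minimal_size F \<ge> 2 \<Longrightarrow>
           threshold X F \<le>
             K * expectation_threshold X F * log 2 (real (largest_minimal_size F))"
  shows "\<And>(X :: 'a set) (F :: 'a set set).
           finite X \<Longrightarrow> increasing_family X F \<Longrightarrow> nontrivial_family X F \<Longrightarrow>
           largest_minimal_size F \<ge> 2 \<Longrightarrow>
           threshold X F \<le>
             1 - exp (- (K * expectation_threshold X F * log 2 (real (largest_minimal_size F))))"
proof -
  fix X :: "'a set" and F :: "'a set set"
  assume "finite X" "increasing_family X F" "nontrivial_family X F"
    and size: "largest_minimal_size F \<ge> 2"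
  then interpret nontrivial_increasing_family X F
    by unfold_locales
  define a where "a = K * log 2 (real (largest_minimal_size F))"
  have "threshold X F \<le> 1 - exp (- (a * expectation_threshold X F))"
  proof (rule threshold_le_one_minus_exp)
    show "0 \<le> a"
      using \<open>K > 0\<close> size by (simp add: a_def)
    fix Y :: "nat set" and \<pi> N
    assume "family_blowup X F Y \<pi> N"
    then interpret family_blowup X F Y \<pi> N .
    show "threshold Y (lift F) \<le> a * expectation_threshold Y (lift F)"
      using assms(2)[OF lifted.finite_ground lifted.increasing lifted.nontrivial] size
      by (simp add: largest_minimal_size_lift[OF subset_Pow] a_def mult_ac)
  qed
  then show "threshold X F \<le>
    1 - exp (- (K * expectation_threshold X F * log 2 (real (largest_minimal_size F))))"
    by (simp add: a_def mult_ac)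
qed

end
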